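(* Let $\mathcal{H}$ be a separable complex Hilbert space and let $T\in\mathcal{B}(\mathcal{H})$ be complex symmetric. If either $T+T^*$ or $T-T^*$ is a diagonal operator, then for every $\varepsilon>0$ there exists a compact operator $K$ on $\mathcal{H}$ with $\|K\|<\varepsilon$ such that $T+K$ is complex symmetric and irreducible.
   Context: $\mathcal{B}(\mathcal{H})$ is the algebra of bounded linear operators on $\mathcal{H}$. A conjugation on $\mathcal{H}$ is a conjugate-linear map $C:\mathcal{H}\to\mathcal{H}$ that is invertible with $C^{-1}=C$ and satisfies $\langle Cx,Cy\rangle=\langle y,x\rangle$ for all $x,y\in\mathcal{H}$. An operator $T\in\mathcal{B}(\mathcal{H})$ is complex symmetric if there is a conjugation $C$ on $\mathcal{H}$ with $CTC=T^*$. An operator is irreducible if it commutes with no (orthogonal) projection other than $0$ and $I$. An operator is diagonal if $\mathcal{H}$ has an orthonormal basis consisting of its eigenvectors. *)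

theory Defs
  imports "HOL-Analysis.Analysis"
begin

section \<open>Complex Hilbert spaces\<close>

text \<open>
  The norm and the topology are those of \<^class>\<open>real_normed_vector\<close>; the complex structure is required to
  extend the real one and the inner product to induce the norm.  The inner product is linear in
  its first argument.  Its positive definiteness is part of \<open>cinner_self\<close>.
\<close>

class complex_inner = real_normed_vector +
  fixes scaleC :: "complex \<Rightarrow> 'a \<Rightarrow> 'a" (infixr "*\<^sub>C" 75)
    and cinner :: "'a \<Rightarrow> 'a \<Rightarrow> complex"
  assumes scaleC_of_real: "of_real r *\<^sub>C x = r *\<^sub>R x"
    and scaleC_add_right: "a *\<^sub>C (x + y) = a *\<^sub>C x + a *\<^sub>C y"
    and scaleC_add_left: "(a + b) *\<^sub>C x = a *\<^sub>C x + b *\<^sub>C x"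
    and scaleC_scaleC: "a *\<^sub>C b *\<^sub>C x = (a * b) *\<^sub>C x"
    and cinner_commute: "cinner x y = cnj (cinner y x)"
    and cinner_add_left: "cinner (x + y) z = cinner x z + cinner y z"
    and cinner_scaleC_left: "cinner (a *\<^sub>C x) y = a * cinner x y"
    and cinner_self: "cinner x x = of_real ((norm x)\<^sup>2)"

class chilbert_space = complex_inner + complete_space

lemma scaleC_one: "1 *\<^sub>C x = (x :: 'a :: complex_inner)"
  using scaleC_of_real[of 1 x] by simp

global_interpretation complex_vector: vector_space "scaleC :: complex \<Rightarrow> 'a \<Rightarrow> 'a :: complex_inner"
  by standard (simp_all add: scaleC_add_right scaleC_add_left scaleC_scaleC scaleC_one)

lemma cinner_add_right: "cinner x (y + z :: 'a :: complex_inner) = cinner x y + cinner x z"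
  by (metis cinner_commute cinner_add_left complex_cnj_add)

lemma cinner_diff_right: "cinner x (y - z :: 'a :: complex_inner) = cinner x y - cinner x z"
  using cinner_add_right[of x "y - z" z] by simp

instantiation complex :: chilbert_space
begin

definition "scaleC_complex (a :: complex) (x :: complex) = a * x"
definition "cinner_complex (x :: complex) (y :: complex) = x * cnj y"

instance
  by standard
    (simp_all add: scaleC_complex_def cinner_complex_def scaleR_conv_of_real algebra_simps
      complex_norm_square[symmetric] flip: of_real_power)

end

section \<open>Bounded operators\<close>

definition bounded_clinear :: "('a :: complex_inner \<Rightarrow> 'a) \<Rightarrow> bool" where
  "bounded_clinear T \<longleftrightarrow> bounded_linear T \<and> (\<forall>a x. T (a *\<^sub>C x) = a *\<^sub>C T x)"

text \<open>
  For bounded operators on a Hilbert space the adjoint exists by the Riesz representation theorem;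
  outside of that setting \<open>cadjoint\<close> may be unspecified.
\<close>

definition cadjoint :: "('a :: complex_inner \<Rightarrow> 'a) \<Rightarrow> 'a \<Rightarrow> 'a" where
  "cadjoint T = (THE S. \<forall>x y. cinner (T x) y = cinner x (S y))"

lemma cadjoint_eqI:
  fixes T S :: "'a :: complex_inner \<Rightarrow> 'a"
  assumes "\<And>x y. cinner (T x) y = cinner x (S y)"
  shows "cadjoint T = S"
  unfolding cadjoint_def
proof (rule the_equality)
  show "\<forall>x y. cinner (T x) y = cinner x (S y)"
    using assms by blast
next
  fix R assume R: "\<forall>x y. cinner (T x) y = cinner x (R y)"
  show "R = S"
  proof
    fix y
    have "cinner (R y - S y) (R y - S y) = 0"
      using R assms by (simp add: cinner_diff_right)
    then show "R y = S y"
      by (simp add: cinner_self)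
  qed
qed

definition compact_operator :: "('a :: complex_inner \<Rightarrow> 'a) \<Rightarrow> bool" where
  "compact_operator K \<longleftrightarrow> bounded_clinear K \<and> compact (closure (K ` cball 0 1))"

definition conjugation :: "('a :: complex_inner \<Rightarrow> 'a) \<Rightarrow> bool" where
  "conjugation C \<longleftrightarrow>
    (\<forall>x y. C (x + y) = C x + C y) \<and>
    (\<forall>a x. C (a *\<^sub>C x) = cnj a *\<^sub>C C x) \<and>
    (\<forall>x. C (C x) = x) \<and>
    (\<forall>x y. cinner (C x) (C y) = cinner y x)"

definition complex_symmetric :: "('a :: complex_inner \<Rightarrow> 'a) \<Rightarrow> bool" where
  "complex_symmetric T \<longleftrightarrow>
    bounded_clinear T \<and> (\<exists>C. conjugation C \<and> C \<circ> T \<circ> C = cadjoint T)"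

definition projection :: "('a :: complex_inner \<Rightarrow> 'a) \<Rightarrow> bool" where
  "projection P \<longleftrightarrow> bounded_clinear P \<and> P \<circ> P = P \<and> cadjoint P = P"

definition irreducible_operator :: "('a :: complex_inner \<Rightarrow> 'a) \<Rightarrow> bool" where
  "irreducible_operator T \<longleftrightarrow>
    bounded_clinear T \<and>
    (\<forall>P. projection P \<and> P \<circ> T = T \<circ> P \<longrightarrow> P = (\<lambda>x. 0) \<or> P = id)"

definition eigenvector :: "('a :: complex_inner \<Rightarrow> 'a) \<Rightarrow> 'a \<Rightarrow> bool" where
  "eigenvector T v \<longleftrightarrow> v \<noteq> 0 \<and> (\<exists>a. T v = a *\<^sub>C v)"

definition orthonormal_basis :: "'a :: complex_inner set \<Rightarrow> bool" where
  "orthonormal_basis B \<longleftrightarrow>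
    (\<forall>u\<in>B. norm u = 1) \<and>
    (\<forall>u\<in>B. \<forall>v\<in>B. u \<noteq> v \<longrightarrow> cinner u v = 0) \<and>
    closure (complex_vector.span B) = UNIV"

definition diagonal_operator :: "('a :: complex_inner \<Rightarrow> 'a) \<Rightarrow> bool" where
  "diagonal_operator T \<longleftrightarrow>
    bounded_clinear T \<and> (\<exists>B. orthonormal_basis B \<and> (\<forall>v\<in>B. eigenvector T v))"

end

theory Submission
  imports Defs
begin

text \<open>
  Let \<open>C\<close> be a conjugation with \<open>C T C = T\<^sup>*\<close>, and suppose that \<open>S = T + T\<^sup>*\<close> is diagonal; the other case follows on
  replacing \<open>T\<close> by \<open>\<i> T\<close>.  Then \<open>C\<close> commutes with \<open>S\<close>, whose eigenvalues are real, so \<open>C\<close> preserves the eigenspaces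
  of \<open>S\<close>, and \<open>S\<close> has an orthonormal eigenbasis \<open>g\<close> of vectors fixed by \<open>C\<close>
  (\<open>conjugation_fixed_eigenbasis\<close>).

  An operator \<open>T\<close> is irreducible as soon as \<open>T + T\<^sup>*\<close> is diagonal in some orthonormal basis with pairwise different eigenvalues,
  while \<open>T - T\<^sup>*\<close> has no vanishing off-diagonal entry in it: a projection commuting with \<open>T\<close> commutes with both parts,
  hence is diagonal by the first and scalar by the second
  (\<open>irreducible_if_distinct_eigenvalues_and_nonzero_entries\<close>).

  Both conditions are achieved by one real parameter.  Put \<open>D x = \<Sum>n. (1/2)^n \<langle>x, g n\<rangle> g n\<close> and
  \<open>v = \<Sum>n. (1/2)^n g n\<close>, and perturb by
  \<open>K x = t (D x + \<i> \<langle>x, v\<rangle> v)\<close>.  This is compact of norm at most \<open>6 t\<close>, and since \<open>C\<close> fixes every \<open>g n\<close>, it satisfies \<open>C K C = K\<^sup>*\<close>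
  for the same \<open>C\<close>.  The differences of eigenvalues of the perturbed \<open>T + T\<^sup>*\<close> and the entries of the perturbed \<open>T - T\<^sup>*\<close> are
  nonconstant affine functions of \<open>t\<close>, so each vanishes for at most one \<open>t\<close>.  There are countably many of them, hence
  arbitrarily small \<open>t > 0\<close> avoid all these zeros (\<open>irreducible_perturbation_if_real_part_diagonal\<close>).
\<close>

section \<open>Inner product and scalar multiplication\<close>

instance chilbert_space \<subseteq> banach ..

lemma cinner_zero_left [simp]: "cinner 0 (x :: 'a :: complex_inner) = 0"
  using cinner_add_left[of 0 0 x] by simp

lemma cinner_zero_right [simp]: "cinner (x :: 'a :: complex_inner) 0 = 0"
  using cinner_add_right[of x 0 0] by simp

lemma cinner_diff_left: "cinner (x - y) (z :: 'a :: complex_inner) = cinner x z - cinner y z"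
  using cinner_add_left[of "x - y" y z] by simp

lemma cinner_scaleC_right: "cinner (x :: 'a :: complex_inner) (a *\<^sub>C y) = cnj a * cinner x y"
  by (metis cinner_commute cinner_scaleC_left complex_cnj_mult)

lemma cinner_scaleR_left: "cinner (r *\<^sub>R x) (y :: 'a :: complex_inner) = of_real r * cinner x y"
  by (metis cinner_scaleC_left scaleC_of_real)

lemma cinner_scaleR_right: "cinner (x :: 'a :: complex_inner) (r *\<^sub>R y) = of_real r * cinner x y"
  by (metis cinner_scaleC_right scaleC_of_real complex_cnj_complex_of_real)

lemmas cinner_simps = cinner_add_left cinner_add_right cinner_diff_left cinner_diff_right
  cinner_scaleC_left cinner_scaleC_right cinner_scaleR_left cinner_scaleR_right

lemma cinner_sum_left: "cinner (\<Sum>i\<in>A. f i) (y :: 'a :: complex_inner) = (\<Sum>i\<in>A. cinner (f i) y)"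
  by (induction A rule: infinite_finite_induct) (simp_all add: cinner_add_left)

lemma cinner_eq_zero_iff [simp]: "cinner x x = 0 \<longleftrightarrow> (x :: 'a :: complex_inner) = 0"
  by (simp add: cinner_self)

lemma cinner_eq_zero_commute: "cinner x y = 0 \<longleftrightarrow> cinner y (x :: 'a :: complex_inner) = 0"
  by (metis cinner_commute complex_cnj_zero)

lemma norm_power2_eq_cinner: "(norm (x :: 'a :: complex_inner))\<^sup>2 = Re (cinner x x)"
  by (simp add: cinner_self)

lemma cinner_extensionality:
  assumes "\<And>z. cinner x z = cinner y (z :: 'a :: complex_inner)"
  shows "x = y"
  using assms[of "x - y"] cinner_eq_zero_iff[of "x - y"] unfolding cinner_diff_left by simp

lemma norm_scaleC: "norm (a *\<^sub>C (x :: 'a :: complex_inner)) = norm a * norm x"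
proof -
  have "complex_of_real ((norm (a *\<^sub>C x))\<^sup>2) = a * cnj a * cinner x x"
    unfolding cinner_self[symmetric] by (simp add: cinner_simps)
  also have "\<dots> = complex_of_real ((norm a * norm x)\<^sup>2)"
    by (simp add: cinner_self power_mult_distrib complex_norm_square[symmetric])
  finally have "(norm (a *\<^sub>C x))\<^sup>2 = (norm a * norm x)\<^sup>2"
    using of_real_eq_iff by blast
  then show ?thesis
    by simp
qed

lemma scaleC_scaleR: "a *\<^sub>C (r *\<^sub>R x) = r *\<^sub>R (a *\<^sub>C (x :: 'a :: complex_inner))"
  by (simp add: scaleC_of_real[symmetric] scaleC_scaleC mult.commute)

lemma bounded_linear_scaleC_right: "bounded_linear (\<lambda>x :: 'a :: complex_inner. a *\<^sub>C x)"
  by (rule bounded_linear_intro[where K = "norm a"])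
    (simp_all add: scaleC_add_right scaleC_scaleR norm_scaleC)

lemma bounded_linear_scaleC_left: "bounded_linear (\<lambda>a. a *\<^sub>C (x :: 'a :: complex_inner))"
  by (rule bounded_linear_intro[where K = "norm x"])
    (simp_all add: scaleC_add_left scaleR_conv_of_real scaleC_of_real[symmetric] scaleC_scaleC norm_scaleC)

lemma Cauchy_Schwarz_cinner: "norm (cinner x y) \<le> norm x * norm (y :: 'a :: complex_inner)"
proof (cases "y = 0")
  case False
  define N where "N = (norm y)\<^sup>2"
  define p where "p = cinner x y"
  have p': "cinner y x = cnj p"
    unfolding p_def by (rule cinner_commute)
  \<comment> \<open>Up to the factor \<open>N\<close>, \<open>z\<close> is the component of \<open>x\<close> orthogonal to \<open>y\<close>.\<close>
  define z where "z = N *\<^sub>R x - p *\<^sub>C y"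
  have "cinner z z = of_real N * (of_real N * cinner x x - p * cnj p)"
    unfolding z_def by (simp add: cinner_simps p' flip: p_def)
      (simp add: cinner_self N_def algebra_simps)
  then have "complex_of_real ((norm z)\<^sup>2) = complex_of_real (N * (N * (norm x)\<^sup>2 - (norm p)\<^sup>2))"
    unfolding cinner_self complex_norm_square[symmetric] by (simp only: of_real_mult of_real_diff)
  then have "(norm z)\<^sup>2 = N * (N * (norm x)\<^sup>2 - (norm p)\<^sup>2)"
    using of_real_eq_iff by blast
  then have "0 \<le> N * (N * (norm x)\<^sup>2 - (norm p)\<^sup>2)"
    by (metis zero_le_power2)
  moreover have "N > 0"
    using False by (simp add: N_def)
  ultimately have "(norm p)\<^sup>2 \<le> (norm x * norm y)\<^sup>2"
    by (simp add: zero_le_mult_iff N_def power_mult_distrib mult.commute)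
  then show ?thesis
    unfolding p_def by (rule power2_le_imp_le) simp
qed simp

lemma bounded_linear_cinner_left: "bounded_linear (\<lambda>x. cinner x (y :: 'a :: complex_inner))"
  by (rule bounded_linear_intro[where K = "norm y"])
    (simp_all add: cinner_simps scaleR_conv_of_real Cauchy_Schwarz_cinner)

lemma bounded_linear_cinner_right: "bounded_linear (\<lambda>y. cinner (x :: 'a :: complex_inner) y)"
  by (rule bounded_linear_intro[where K = "norm x"])
    (simp_all add: cinner_simps scaleR_conv_of_real, metis Cauchy_Schwarz_cinner mult.commute)

lemma bounded_clinearI:
  assumes "\<And>x y. T (x + y) = T x + T y" "\<And>a x. T (a *\<^sub>C x) = a *\<^sub>C T x"
    and "\<And>x. norm (T x) \<le> M * norm x"
  shows "bounded_clinear T"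
  unfolding bounded_clinear_def
proof
  show "bounded_linear T"
    by (rule bounded_linear_intro[where K = M])
      (use assms in \<open>simp_all add: scaleC_of_real[symmetric] mult.commute\<close>)
qed (use assms in blast)

lemma bounded_clinear_add:
  "bounded_clinear S \<Longrightarrow> bounded_clinear T \<Longrightarrow> bounded_clinear (\<lambda>x. S x + T x)"
  unfolding bounded_clinear_def by (auto intro: bounded_linear_add simp: scaleC_add_right)

lemma bounded_clinear_scaleC:
  "bounded_clinear T \<Longrightarrow> bounded_clinear (\<lambda>x. a *\<^sub>C T x)"
  unfolding bounded_clinear_def
  by (auto intro: bounded_linear_compose[OF bounded_linear_scaleC_right] simp: scaleC_scaleC mult.commute)

section \<open>Existence of adjoints\<close>

text \<open>
  The representing vector is the minimizer of \<open>norm x ^ 2 - 2 Re (\<phi> x)\<close>.  By the parallelogram law every minimizing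
  sequence is Cauchy, so completeness provides the minimizer; minimality along each line gives equality of the real parts, and
  replacing \<open>x\<close> by \<open>\<i> x\<close> that of the imaginary parts.
\<close>

lemma Riesz_representation:
  fixes \<phi> :: "'a :: chilbert_space \<Rightarrow> complex"
  assumes "bounded_linear \<phi>" and scaleC: "\<And>a x. \<phi> (a *\<^sub>C x) = a * \<phi> x"
  obtains y where "\<And>x. \<phi> x = cinner x y"
proof -
  interpret bounded_linear \<phi> by fact
  obtain M where M: "\<And>x. norm (\<phi> x) \<le> norm x * M"
    using bounded by blast
  define J where "J x = (norm x)\<^sup>2 - 2 * Re (\<phi> x)" for x
  have "J x \<ge> - M\<^sup>2" for x
  proof -
    have "Re (\<phi> x) \<le> norm x * M"
      using M[of x] complex_Re_le_cmod[of "\<phi> x"] by linarith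
    then show ?thesis
      using zero_le_power2[of "norm x - M"] unfolding J_def power2_diff by simp
  qed
  then have bdd: "bdd_below (range J)"
    by (intro bdd_belowI[of _ "- M\<^sup>2"]) blast
  define m where "m = Inf (range J)"
  have J_ge: "m \<le> J x" for x
    unfolding m_def by (intro cInf_lower bdd) simp
  have "\<exists>x. J x < m + inverse (real (Suc n))" for n
    using cInf_lessD[of "range J" "m + inverse (real (Suc n))"] unfolding m_def by auto
  then obtain X where X: "\<And>n. J (X n) < m + inverse (real (Suc n))"
    by metis
  have parallelogram: "(norm (x - z))\<^sup>2 \<le> 2 * (J x + J z - 2 * m)" for x z
  proof -
    have "(norm (x - z))\<^sup>2 = 2 * (J x + J z - 2 * J ((1/2) *\<^sub>R (x + z)))"
      unfolding J_def norm_power2_eq_cinner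
      by (simp add: cinner_simps scaleR add scaleR_conv_of_real field_simps)
    then show ?thesis
      using J_ge[of "(1/2) *\<^sub>R (x + z)"] by simp
  qed
  have "Cauchy X"
  proof (rule metric_CauchyI)
    fix e :: real assume e: "e > 0"
    then obtain N where N: "inverse (real (Suc N)) < e\<^sup>2 / 4"
      using reals_Archimedean[of "e\<^sup>2 / 4"] by auto
    have "dist (X k) (X l) < e" if "k \<ge> N" "l \<ge> N" for k l
    proof -
      have "inverse (real (Suc k)) \<le> inverse (real (Suc N))" "inverse (real (Suc l)) \<le> inverse (real (Suc N))"
        using that by (simp_all add: le_imp_inverse_le)
      then have "(norm (X k - X l))\<^sup>2 < e\<^sup>2"
        using parallelogram[of "X k" "X l"] X[of k] X[of l] N by argo
      then show ?thesis
        using e by (simp add: dist_norm power2_less_imp_less)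
    qed
    then show "\<exists>N. \<forall>k\<ge>N. \<forall>l\<ge>N. dist (X k) (X l) < e"
      by blast
  qed
  then obtain y where y: "X \<longlonglongrightarrow> y"
    using Cauchy_convergent_iff convergent_def by blast
  have "(\<lambda>n. J (X n)) \<longlonglongrightarrow> J y"
    unfolding J_def by (intro tendsto_intros y tendsto)
  moreover have "(\<lambda>n. m + inverse (real (Suc n))) \<longlonglongrightarrow> m + 0"
    by (intro tendsto_intros LIMSEQ_inverse_real_of_nat)
  ultimately have "J y \<le> m + 0"
    by (rule LIMSEQ_le) (use X less_imp_le in blast)
  then have minimal: "J y \<le> J x" for x
    using J_ge[of x] by simp
  have Re_eq: "Re (\<phi> h) = Re (cinner h y)" for h
  proof (rule ccontr)
    assume neq: "Re (\<phi> h) \<noteq> Re (cinner h y)"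
    define d where "d = Re (\<phi> h) - Re (cinner h y)"
    \<comment> \<open>Adding \<open>1\<close> to the optimal step's denominator also covers \<open>h = 0\<close>.\<close>
    define r where "r = d / ((norm h)\<^sup>2 + 1)"
    have pos: "(norm h)\<^sup>2 + 1 > 0"
      by (simp add: add_nonneg_pos)
    have "Re (cinner y h) = Re (cinner h y)"
      by (subst cinner_commute) simp
    then have "J (y + r *\<^sub>R h) = J y + r\<^sup>2 * (norm h)\<^sup>2 - 2 * r * d"
      unfolding J_def norm_power2_eq_cinner d_def
      by (simp add: cinner_simps add scaleR power2_eq_square algebra_simps)
    also have "r\<^sup>2 * (norm h)\<^sup>2 - 2 * r * d = r\<^sup>2 * ((norm h)\<^sup>2 + 1) - r\<^sup>2 - 2 * r * d"
      by (simp add: algebra_simps)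
    then have "J y + r\<^sup>2 * (norm h)\<^sup>2 - 2 * r * d = J y - r * d - r\<^sup>2"
      using pos by (simp add: r_def power2_eq_square)
    finally have "r * d + r\<^sup>2 \<le> 0"
      using minimal[of "y + r *\<^sub>R h"] by simp
    moreover have "r * d > 0"
    proof -
      have "d\<^sup>2 > 0"
        using neq by (simp add: d_def)
      then show ?thesis
        using pos by (simp add: r_def flip: power2_eq_square)
    qed
    ultimately show False
      using zero_le_power2[of r] by linarith
  qed
  show thesis
  proof (rule that)
    fix x
    have "Im (\<phi> x) = Im (cinner x y)"
      using Re_eq[of "\<i> *\<^sub>C x"] by (simp add: scaleC cinner_simps)
    with Re_eq[of x] show "\<phi> x = cinner x y"
      by (simp add: complex_eq_iff)
  qed
qed

text \<open>
  The description operator in \<open>cadjoint\<close> yields the adjoint only once one is known to exist; Riesz representation of the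
  functionals \<open>x \<mapsto> \<langle>T x, y\<rangle>\<close> provides it.
\<close>

lemma cinner_cadjoint:
  fixes T :: "'a :: chilbert_space \<Rightarrow> 'a"
  assumes "bounded_clinear T"
  shows "cinner (T x) y = cinner x (cadjoint T y)"
proof -
  have T: "bounded_linear T" "\<And>a x. T (a *\<^sub>C x) = a *\<^sub>C T x"
    using assms unfolding bounded_clinear_def by auto
  have "\<exists>z. \<forall>x. cinner (T x) y = cinner x z" for y
  proof -
    have "bounded_linear (\<lambda>x. cinner (T x) y)"
      using bounded_linear_compose[OF bounded_linear_cinner_left T(1)] .
    then obtain z where "\<And>x. cinner (T x) y = cinner x z"
      by (rule Riesz_representation) (auto simp: T cinner_simps)
    then show ?thesis by blast
  qed
  then obtain S where S: "\<And>x y. cinner (T x) y = cinner x (S y)"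
    by metis
  then show ?thesis
    using cadjoint_eqI[of T S] by simp
qed

section \<open>Conjugations\<close>

lemma conjugationD:
  assumes "conjugation C"
  shows conjugation_add: "C (x + y) = C x + C y"
    and conjugation_scaleC: "C (a *\<^sub>C x) = cnj a *\<^sub>C C x"
    and conjugation_involution: "C (C x) = x"
    and conjugation_cinner: "cinner (C x) (C y) = cinner y x"
  using assms unfolding conjugation_def by blast+

lemma bounded_linear_conjugation:
  assumes "conjugation C"
  shows "bounded_linear C"
proof (rule bounded_linear_intro[where K = 1])
  show "C (r *\<^sub>R x) = r *\<^sub>R C x" for r x
    using conjugation_scaleC[OF assms, of "of_real r" x] by (simp add: scaleC_of_real)
  show "norm (C x) \<le> norm x * 1" for x
    using conjugation_cinner[OF assms, of x x] norm_power2_eq_cinner[of x] norm_power2_eq_cinner[of "C x"]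
    by (metis mult.right_neutral norm_ge_zero order_refl power2_eq_iff_nonneg)
qed (rule conjugation_add[OF assms])

text \<open>
  Applying \<open>C\<close> to both arguments swaps them.  If \<open>C\<close> fixes \<open>x\<close> as well, this says that their inner product is real, which
  is why Gram-Schmidt does not leave the fixed vectors of \<open>C\<close>.
\<close>

lemma cnj_cinner_fixed:
  assumes "conjugation C" "C y = y"
  shows "cnj (cinner x y) = cinner (C x) y"
  using conjugation_cinner[OF assms(1), of x y] assms(2) cinner_commute[of y x] by simp

section \<open>Gram-Schmidt orthonormalization of a sequence\<close>

text \<open>
  The input may be linearly dependent: redundant vectors are sent to \<open>0\<close>, because \<open>sgn 0 = 0\<close>.  Keeping the zeros
  instead of thinning out the sequence treats finite and infinite dimension alike.
\<close>

fun gram_schmidt :: "(nat \<Rightarrow> 'a :: complex_inner) \<Rightarrow> nat \<Rightarrow> 'a" where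
  "gram_schmidt u n = sgn (u n - (\<Sum>m<n. cinner (u n) (gram_schmidt u m) *\<^sub>C gram_schmidt u m))"

declare gram_schmidt.simps [simp del]

lemma gram_schmidt_zero_or_unit: "gram_schmidt u n = 0 \<or> norm (gram_schmidt u n) = 1"
  by (subst (1 2) gram_schmidt.simps) (simp add: norm_sgn sgn_zero_iff)

lemma gram_schmidt_orthogonal_less:
  "m < n \<Longrightarrow> cinner (gram_schmidt u n) (gram_schmidt u m) = 0"
proof (induction n arbitrary: m rule: less_induct)
  case (less n)
  let ?g = "gram_schmidt u"
  have orth: "cinner (?g k) (?g m) = 0" if "k < n" "k \<noteq> m" for k
    using less.IH[of k m] less.IH[of m k] that less.prems cinner_eq_zero_commute
    by (metis linorder_neqE_nat)
  have "(\<Sum>k<n. cinner (u n) (?g k) * cinner (?g k) (?g m))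
      = (\<Sum>k\<in>{m}. cinner (u n) (?g k) * cinner (?g k) (?g m))"
    using less.prems orth by (intro sum.mono_neutral_right) auto
  also have "\<dots> = cinner (u n) (?g m)"
    using gram_schmidt_zero_or_unit[of u m] by (auto simp: cinner_self)
  finally have "cinner (u n - (\<Sum>k<n. cinner (u n) (?g k) *\<^sub>C ?g k)) (?g m) = 0"
    by (simp add: cinner_simps cinner_sum_left)
  then show ?case
    by (subst gram_schmidt.simps) (simp add: sgn_div_norm cinner_simps)
qed

lemma gram_schmidt_orthogonal:
  "m \<noteq> n \<Longrightarrow> cinner (gram_schmidt u m) (gram_schmidt u n) = 0"
  using gram_schmidt_orthogonal_less cinner_eq_zero_commute by (metis linorder_neqE_nat)

lemma gram_schmidt_total:
  assumes "\<And>n. cinner (gram_schmidt u n) x = 0"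
  shows "cinner (u n) x = 0"
proof -
  let ?r = "u n - (\<Sum>m<n. cinner (u n) (gram_schmidt u m) *\<^sub>C gram_schmidt u m)"
  have "?r = norm ?r *\<^sub>R gram_schmidt u n"
    unfolding gram_schmidt.simps[of u n] sgn_div_norm by (cases "?r = 0") simp_all
  then have "cinner ?r x = 0"
    by (metis assms cinner_scaleR_left mult_zero_right)
  then show ?thesis
    by (simp add: cinner_simps cinner_sum_left assms)
qed

lemma gram_schmidt_fixed:
  assumes C: "conjugation C" and u: "\<And>n. C (u n) = u n"
  shows "C (gram_schmidt u n) = gram_schmidt u n"
proof (induction n rule: less_induct)
  case (less n)
  interpret C: bounded_linear C
    using C by (rule bounded_linear_conjugation)
  have "C (\<Sum>m<n. cinner (u n) (gram_schmidt u m) *\<^sub>C gram_schmidt u m)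
      = (\<Sum>m<n. cinner (u n) (gram_schmidt u m) *\<^sub>C gram_schmidt u m)"
    unfolding C.sum
    by (intro sum.cong refl) (simp add: conjugation_scaleC[OF C] less.IH cnj_cinner_fixed[OF C] u)
  then show ?case
    by (subst (1 2) gram_schmidt.simps) (simp add: sgn_div_norm C.scaleR C.diff u)
qed

text \<open>
  Eigenvectors of a symmetric operator for different eigenvalues are orthogonal.  Hence only vectors from the
  same eigenspace are subtracted from \<open>u n\<close>, and its eigenvalue survives.
\<close>

lemma gram_schmidt_eigenvector:
  assumes S: "bounded_clinear S" and sym: "\<And>x y. cinner (S x) y = cinner x (S y)"
    and u: "\<And>n. S (u n) = s n *\<^sub>R u n"
  shows "S (gram_schmidt u n) = s n *\<^sub>R gram_schmidt u n"
proof (induction n rule: less_induct)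
  case (less n)
  let ?g = "gram_schmidt u"
  interpret S: bounded_linear S
    using S unfolding bounded_clinear_def by blast
  have S_scaleC: "S (a *\<^sub>C x) = a *\<^sub>C S x" for a x
    using S unfolding bounded_clinear_def by blast
  have "S (cinner (u n) (?g m) *\<^sub>C ?g m) = s n *\<^sub>R (cinner (u n) (?g m) *\<^sub>C ?g m)" if "m < n" for m
  proof -
    have "of_real (s n) * cinner (u n) (?g m) = of_real (s m) * cinner (u n) (?g m)"
      using sym[of "u n" "?g m"] less.IH[OF that] by (simp add: u cinner_simps)
    then show ?thesis
      by (auto simp: S_scaleC less.IH[OF that] scaleC_scaleR)
  qed
  then have "S (\<Sum>m<n. cinner (u n) (?g m) *\<^sub>C ?g m) = s n *\<^sub>R (\<Sum>m<n. cinner (u n) (?g m) *\<^sub>C ?g m)"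
    by (simp add: S.sum scaleR_sum_right)
  then show ?case
    by (subst (1 2) gram_schmidt.simps) (simp add: sgn_div_norm S.scaleR S.diff u scaleR_diff_right mult.commute)
qed

section \<open>Eigenbases fixed by a conjugation\<close>

text \<open>
  Distinct orthonormal vectors have distance \<open>\<surd>2\<close>, so no point of a dense set is within \<open>1/2\<close> of two of them.
\<close>

lemma countable_orthonormal_set:
  fixes B :: "'a :: complex_inner set"
  assumes "separable_space (euclidean :: 'a topology)"
    and unit: "\<And>u. u \<in> B \<Longrightarrow> norm u = 1"
    and orth: "\<And>u v. u \<in> B \<Longrightarrow> v \<in> B \<Longrightarrow> u \<noteq> v \<Longrightarrow> cinner u v = 0"
  shows "countable B"
proof -
  obtain D :: "'a set" where D: "countable D" "closure D = UNIV"
    using assms(1) unfolding separable_space_def by auto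
  have "\<exists>d\<in>D. dist d u < 1/2" for u
    using closure_approachable[of u D] D(2) by (metis UNIV_I half_gt_zero zero_less_one)
  then obtain d where d: "\<And>u. d u \<in> D" "\<And>u. dist (d u) u < 1/2"
    by metis
  have "inj_on d B"
  proof (rule inj_onI, rule ccontr)
    fix u v assume uv: "u \<in> B" "v \<in> B" "d u = d v" "u \<noteq> v"
    have "dist u v < 1"
      using d(2)[of u] d(2)[of v] uv(3) dist_triangle2[of u v "d u"] by (simp add: dist_commute)
    then have "(norm (u - v))\<^sup>2 < 1"
      by (simp add: dist_norm power_less_one_iff abs_square_less_1)
    moreover have "(norm (u - v))\<^sup>2 = 2"
      using uv orth unit
      by (simp add: norm_power2_eq_cinner cinner_simps) (simp add: cinner_self)
    ultimately show False
      by simp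
  qed
  then show ?thesis
    using D(1) d(1) by (meson countable_image_inj_on countable_subset image_subset_iff)
qed

lemma orthogonal_to_dense_span:
  fixes x :: "'a :: complex_inner"
  assumes "closure (complex_vector.span B) = UNIV" and "\<And>b. b \<in> B \<Longrightarrow> cinner b x = 0"
  shows "x = 0"
proof -
  have "complex_vector.span B \<subseteq> {y. cinner y x = 0}"
    using assms(2) by (intro complex_vector.span_minimal complex_vector.subspaceI)
      (auto simp: cinner_simps)
  moreover have "closed {y. cinner y x = 0}"
    by (intro closed_Collect_eq continuous_intros linear_continuous_on bounded_linear_cinner_left)
  ultimately have "closure (complex_vector.span B) \<subseteq> {y. cinner y x = 0}"
    by (rule closure_minimal)
  then show ?thesis
    using assms(1) cinner_eq_zero_iff[of x] by blast
qed

text \<open>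
  The eigenspaces are invariant under \<open>C\<close>, because their eigenvalues are real.  So each eigenvector \<open>b\<close> is a combination
  of the fixed eigenvectors \<open>b + C b\<close> and \<open>\<i> (b - C b)\<close>, and Gram-Schmidt applied to all of these
  stays within the fixed eigenvectors.
\<close>

lemma conjugation_fixed_eigenbasis:
  fixes S :: "'a :: complex_inner \<Rightarrow> 'a"
  assumes sep: "separable_space (euclidean :: 'a topology)"
    and C: "conjugation C"
    and diag: "diagonal_operator S"
    and sym: "\<And>x y. cinner (S x) y = cinner x (S y)"
    and comm: "\<And>x. S (C x) = C (S x)"
  obtains g :: "nat \<Rightarrow> 'a" and s :: "nat \<Rightarrow> real" where
    "\<And>n. g n = 0 \<or> norm (g n) = 1"
    "\<And>m n. m \<noteq> n \<Longrightarrow> cinner (g m) (g n) = 0"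
    "\<And>x. (\<And>n. cinner (g n) x = 0) \<Longrightarrow> x = 0"
    "\<And>n. C (g n) = g n"
    "\<And>n. S (g n) = s n *\<^sub>R g n"
proof -
  interpret C: bounded_linear C
    using C by (rule bounded_linear_conjugation)
  obtain B where S: "bounded_clinear S" and "orthonormal_basis B" and eig: "\<And>b. b \<in> B \<Longrightarrow> eigenvector S b"
    using diag unfolding diagonal_operator_def by blast
  then have unit: "\<And>b. b \<in> B \<Longrightarrow> norm b = 1"
    and orth: "\<And>b c. b \<in> B \<Longrightarrow> c \<in> B \<Longrightarrow> b \<noteq> c \<Longrightarrow> cinner b c = 0"
    and dense: "closure (complex_vector.span B) = UNIV"
    unfolding orthonormal_basis_def by auto
  interpret S: bounded_linear S
    using S unfolding bounded_clinear_def by blast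
  have S_scaleC: "S (a *\<^sub>C x) = a *\<^sub>C S x" for a x
    using S unfolding bounded_clinear_def by blast
  have real_eig: "\<exists>r. S b = r *\<^sub>R b" if b: "b \<in> B" for b
  proof -
    obtain a where a: "S b = a *\<^sub>C b" and "b \<noteq> 0"
      using eig[OF b] unfolding eigenvector_def by blast
    have "a * cinner b b = cnj a * cinner b b"
      using sym[of b b] by (simp add: a cinner_simps)
    then have "a = cnj a"
      using \<open>b \<noteq> 0\<close> by simp
    then have "a = of_real (Re a)"
      by (simp add: complex_eq_iff)
    then show ?thesis
      using a scaleC_of_real[of "Re a" b] by metis
  qed
  define U where "U = {0} \<union> (\<lambda>b. b + C b) ` B \<union> (\<lambda>b. \<i> *\<^sub>C (b - C b)) ` B"
  have U_fixed: "C x = x" if "x \<in> U" for x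
    using that unfolding U_def
    by (auto simp: C.zero C.add conjugationD[OF C] add.commute)
      (simp add: C.diff conjugationD[OF C] complex_vector.scale_right_diff_distrib)
  have U_eig: "\<exists>r. S x = r *\<^sub>R x" if x: "x \<in> U" for x
  proof -
    consider "x = 0" | b where "b \<in> B" "x = b + C b" | b where "b \<in> B" "x = \<i> *\<^sub>C (b - C b)"
      using x unfolding U_def by blast
    then show ?thesis
    proof cases
      case 1
      then show ?thesis by (simp add: S.zero)
    next
      case 2
      then show ?thesis
        using real_eig[of b] by (auto simp: S.add comm C.scaleR scaleR_add_right)
    next
      case 3
      then show ?thesis
        using real_eig[of b]
        by (auto simp: S_scaleC S.diff comm C.scaleR scaleC_scaleR simp flip: scaleR_diff_right)
    qed
  qed
  have "countable U"
    unfolding U_def using countable_orthonormal_set[OF sep unit orth] by auto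
  then obtain u :: "nat \<Rightarrow> 'a" where u: "range u = U"
    using range_from_nat_into[of U] unfolding U_def by blast
  then have "\<forall>n. \<exists>r. S (u n) = r *\<^sub>R u n"
    using U_eig by blast
  then obtain s where s: "\<And>n. S (u n) = s n *\<^sub>R u n"
    by metis
  show thesis
  proof (rule that[of "gram_schmidt u" s])
    show "gram_schmidt u n = 0 \<or> norm (gram_schmidt u n) = 1" for n
      by (rule gram_schmidt_zero_or_unit)
    show "cinner (gram_schmidt u m) (gram_schmidt u n) = 0" if "m \<noteq> n" for m n
      using that by (rule gram_schmidt_orthogonal)
    show "C (gram_schmidt u n) = gram_schmidt u n" for n
      using C by (rule gram_schmidt_fixed) (use u U_fixed in blast)
    show "S (gram_schmidt u n) = s n *\<^sub>R gram_schmidt u n" for n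
      using S sym s by (rule gram_schmidt_eigenvector)
  next
    fix x assume "\<And>n. cinner (gram_schmidt u n) x = 0"
    then have "cinner (u n) x = 0" for n
      by (rule gram_schmidt_total)
    then have U_orth: "cinner y x = 0" if "y \<in> U" for y
      using u that by blast
    have "cinner b x = 0" if "b \<in> B" for b
    proof -
      have "cinner (b + C b) x = 0" "cinner (\<i> *\<^sub>C (b - C b)) x = 0"
        using that by (intro U_orth; simp add: U_def)+
      then show ?thesis
        by (simp add: cinner_simps)
    qed
    with dense show "x = 0"
      by (rule orthogonal_to_dense_span)
  qed
qed

section \<open>A compactness criterion\<close>

text \<open>
  The coordinates \<open>c n x\<close> of \<open>x\<close> in the unit ball lie in the product of the discs of radius \<open>M\<close>, which is
  compact by Tychonoff's theorem.  The weights make the series a uniform limit, hence a continuous function of the coordinates,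
  so \<open>K\<close> maps the unit ball into a continuous image of a compact set.
\<close>

lemma compact_operator_weighted_series:
  fixes g :: "nat \<Rightarrow> 'a :: chilbert_space"
  assumes K: "bounded_clinear K"
    and g: "\<And>n. norm (g n) \<le> 1"
    and c: "\<And>n x. norm x \<le> 1 \<Longrightarrow> norm (c n x) \<le> M"
    and sums: "\<And>x. (\<lambda>n. (1/2)^n *\<^sub>R (c n x *\<^sub>C g n)) sums K x"
  shows "compact_operator K"
proof -
  define Q :: "(nat \<Rightarrow> complex) set" where "Q = (\<Pi>\<^sub>E n\<in>UNIV. cball 0 M)"
  define F where "F q = (\<Sum>n. (1/2)^n *\<^sub>R (q n *\<^sub>C g n))" for q
  have "compactin (product_topology (\<lambda>n :: nat. euclidean :: complex topology) UNIV) Q"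
    unfolding Q_def compactin_PiE by simp
  then have "compact Q"
    by (simp add: euclidean_product_topology)
  have "uniform_limit Q (\<lambda>k q. \<Sum>n<k. (1/2)^n *\<^sub>R (q n *\<^sub>C g n)) F sequentially"
    unfolding F_def
  proof (rule Weierstrass_m_test)
    show "norm ((1/2)^n *\<^sub>R (q n *\<^sub>C g n)) \<le> M * (1/2)^n" if "q \<in> Q" for n q
    proof -
      have "norm (q n) \<le> M"
        using that by (auto simp: Q_def PiE_iff)
      then have "norm (q n) * norm (g n) \<le> M * 1"
        using g[of n] by (intro mult_mono) (auto intro: order_trans[OF norm_ge_zero])
      then show ?thesis
        using mult_right_mono[of "norm (q n) * norm (g n)" "M" "(1/2)^n"]
        by (simp add: norm_scaleC mult.commute)
    qed
    show "summable (\<lambda>n. M * (1/2)^n)"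
      by (intro summable_mult summable_geometric) simp
  qed
  then have "continuous_on Q F"
  proof (rule uniform_limit_theorem[rotated])
    have "continuous_on Q (\<lambda>q. q n *\<^sub>C g n)" for n
      by (rule continuous_on_compose2[OF linear_continuous_on[OF bounded_linear_scaleC_left]])
        (auto intro: continuous_on_subset[OF continuous_on_product_coordinates])
    then show "\<forall>\<^sub>F k in sequentially. continuous_on Q (\<lambda>q. \<Sum>n<k. (1/2)^n *\<^sub>R (q n *\<^sub>C g n))"
      by (intro always_eventually allI continuous_intros)
  qed simp
  then have "compact (F ` Q)"
    using \<open>compact Q\<close> by (rule compact_continuous_image)
  moreover have "K ` cball 0 1 \<subseteq> F ` Q"
  proof
    fix y assume "y \<in> K ` cball 0 1"
    then obtain x where x: "norm x \<le> 1" "y = K x"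
      by auto
    then have "(\<lambda>n. c n x) \<in> Q"
      using c by (auto simp: Q_def)
    moreover have "y = F (\<lambda>n. c n x)"
      unfolding F_def x(2) using sums by (rule sums_unique)
    ultimately show "y \<in> F ` Q"
      by blast
  qed
  ultimately have "closure (K ` cball 0 1) \<subseteq> F ` Q"
    by (simp add: closure_minimal compact_imp_closed)
  then have "compact (closure (K ` cball 0 1))"
    using compact_Int_closed[OF \<open>compact (F ` Q)\<close> closed_closure] by (metis inf.absorb2)
  then show ?thesis
    using K unfolding compact_operator_def by blast
qed

section \<open>An irreducibility criterion\<close>

text \<open>
  Projections are self-adjoint, so one that commutes with \<open>T\<close> also commutes with the adjoint, and hence with both
  parts \<open>T + T\<^sup>*\<close> and \<open>T - T\<^sup>*\<close>.  Since the eigenvalues of the first are distinct, the projection is diagonal in the same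
  basis; since no off-diagonal entry of the second vanishes, all its diagonal entries agree.
\<close>

lemma irreducible_if_distinct_eigenvalues_and_nonzero_entries:
  fixes T :: "'a :: chilbert_space \<Rightarrow> 'a" and g :: "'i \<Rightarrow> 'a" and s :: "'i \<Rightarrow> real"
  assumes T: "bounded_clinear T"
    and adj: "\<And>x y. cinner (T x) y = cinner x (T' y)"
    and orth: "\<And>m n. m \<noteq> n \<Longrightarrow> cinner (g m) (g n) = 0"
    and total: "\<And>x. (\<And>n. cinner (g n) x = 0) \<Longrightarrow> x = 0"
    and eig: "\<And>n. T (g n) + T' (g n) = s n *\<^sub>R g n"
    and distinct: "\<And>m n. m \<noteq> n \<Longrightarrow> g m \<noteq> 0 \<Longrightarrow> g n \<noteq> 0 \<Longrightarrow> s m \<noteq> s n"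
    and entries: "\<And>m n. m \<noteq> n \<Longrightarrow> g m \<noteq> 0 \<Longrightarrow> g n \<noteq> 0 \<Longrightarrow> cinner (T (g m) - T' (g m)) (g n) \<noteq> 0"
  shows "irreducible_operator T"
  unfolding irreducible_operator_def
proof (intro conjI allI impI T, elim conjE)
  fix P :: "'a \<Rightarrow> 'a"
  assume P: "projection P" and comm: "P \<circ> T = T \<circ> P"
  have T_comm: "P (T x) = T (P x)" for x
    using comm by (metis comp_apply)
  have idem: "P (P x) = P x" for x
    using P unfolding projection_def by (metis comp_apply)
  have "bounded_clinear P" "cadjoint P = P"
    using P unfolding projection_def by auto
  interpret P: bounded_linear P
    using P unfolding projection_def bounded_clinear_def by blast
  have P_scaleC: "P (a *\<^sub>C x) = a *\<^sub>C P x" for a x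
    using P unfolding projection_def bounded_clinear_def by blast
  have P_sym: "cinner (P x) y = cinner x (P y)" for x y
    using cinner_cadjoint[OF \<open>bounded_clinear P\<close>] \<open>cadjoint P = P\<close> by simp
  have adj': "cinner (T' x) y = cinner x (T y)" for x y
    by (subst (1 2) cinner_commute) (simp only: adj)
  have T'_comm: "P (T' x) = T' (P x)" for x
    by (rule cinner_extensionality) (simp add: P_sym adj' T_comm)
  have orth_P: "cinner (P (g n)) (g m) = 0" if "m \<noteq> n" for m n
  proof (cases "g m = 0 \<or> g n = 0")
    case False
    have "of_real (s n) * cinner (P (g n)) (g m) = cinner (P (T (g n) + T' (g n))) (g m)"
      by (simp add: eig P.scaleR cinner_simps)
    also have "\<dots> = cinner (P (g n)) (T (g m) + T' (g m))"
      by (simp add: P.add T_comm T'_comm cinner_simps adj adj')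
    also have "\<dots> = of_real (s m) * cinner (P (g n)) (g m)"
      by (simp add: eig cinner_simps)
    finally show ?thesis
      using distinct[OF that] False by auto
  qed (auto simp: P.zero)
  define p where "p n = Re (cinner (P (g n)) (g n)) / (norm (g n))\<^sup>2" for n
  have p: "P (g n) = p n *\<^sub>R g n" if "g n \<noteq> 0" for n
  proof -
    have "cnj (cinner (P (g n)) (g n)) = cinner (P (g n)) (g n)"
      using P_sym[of "g n" "g n"] cinner_commute[of "g n" "P (g n)"] by simp
    then have "of_real (p n) * cinner (g n) (g n) = cinner (P (g n)) (g n)"
      using that unfolding p_def by (simp add: complex_eq_iff cinner_self)
    then have "cinner (P (g n) - p n *\<^sub>R g n) (g m) = 0" for m
      using orth_P[of m n] orth[of n m] by (cases "m = n") (simp_all add: cinner_simps)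
    then have "P (g n) - p n *\<^sub>R g n = 0"
      by (intro total) (metis cinner_eq_zero_commute)
    then show ?thesis
      by simp
  qed
  have p_eq: "p m = p n" if "g m \<noteq> 0" "g n \<noteq> 0" for m n
  proof (cases "m = n")
    case False
    let ?e = "cinner (T (g m) - T' (g m)) (g n)"
    interpret T: bounded_linear T
      using T unfolding bounded_clinear_def by blast
    have "cinner (P (T (g m) - T' (g m))) (g n) = of_real (p m) * ?e"
    proof -
      have "cinner (T' (P (g m))) (g n) = of_real (p m) * cinner (T' (g m)) (g n)"
        unfolding adj' p[OF that(1)] by (simp add: cinner_simps)
      then show ?thesis
        by (simp add: P.diff T_comm T'_comm cinner_simps) (simp add: p[OF that(1)] T.scaleR cinner_simps algebra_simps)
    qed
    moreover have "cinner (P (T (g m) - T' (g m))) (g n) = of_real (p n) * ?e"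
      unfolding P_sym p[OF that(2)] by (simp add: cinner_simps)
    ultimately show ?thesis
      using entries[OF False that] by simp
  qed simp
  have "\<exists>c. \<forall>n. g n \<noteq> 0 \<longrightarrow> p n = c"
    using p_eq by (cases "\<exists>m. g m \<noteq> 0") blast+
  then obtain c where c: "\<And>n. g n \<noteq> 0 \<Longrightarrow> p n = c"
    by blast
  have P_eq: "P x = c *\<^sub>R x" for x
  proof -
    have "cinner (g n) (P x - c *\<^sub>R x) = 0" for n
    proof (cases "g n = 0")
      case False
      have "cinner (g n) (P x) = of_real c * cinner (g n) x"
        using p[OF False] c[OF False] by (simp add: cinner_scaleR_left flip: P_sym)
      then show ?thesis
        by (simp add: cinner_simps)
    qed simp
    then have "P x - c *\<^sub>R x = 0"
      by (rule total)
    then show ?thesis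
      by simp
  qed
  show "P = (\<lambda>x. 0) \<or> P = id"
  proof (cases "\<forall>x :: 'a. x = 0")
    case True
    then show ?thesis by blast
  next
    case False
    then obtain x :: 'a where "x \<noteq> 0"
      by blast
    then have "c * c = c"
      using idem[of x] unfolding P_eq by simp
    then have "c = 0 \<or> c = 1"
      by simp
    then show ?thesis
      by (auto simp: P_eq fun_eq_iff)
  qed
qed

text \<open>
  For each index the condition excludes at most one \<open>t\<close>.
\<close>

lemma countable_roots_of_countably_many_affine_functions:
  fixes a b :: "'i :: countable \<Rightarrow> complex"
  shows "countable {t :: real. \<exists>i. a i \<noteq> 0 \<and> b i + of_real t * a i = 0}"
proof (rule countable_subset)
  show "countable (range (\<lambda>i. Re (- b i / a i)))"
    by simp
  show "{t. \<exists>i. a i \<noteq> 0 \<and> b i + of_real t * a i = 0} \<subseteq> range (\<lambda>i. Re (- b i / a i))"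
  proof safe
    fix t :: real and i assume "a i \<noteq> 0" "b i + of_real t * a i = 0"
    then have "- b i / a i = of_real t"
      by (simp add: field_simps add_eq_0_iff)
    then show "t \<in> range (\<lambda>i. Re (- b i / a i))"
      by (intro range_eqI[of _ _ i]) (simp only: Re_complex_of_real)
  qed
qed

section \<open>The perturbation\<close>

locale orthonormal_sequence =
  fixes g :: "nat \<Rightarrow> 'a :: chilbert_space"
  assumes zero_or_unit: "g n = 0 \<or> norm (g n) = 1"
    and orthogonal: "m \<noteq> n \<Longrightarrow> cinner (g m) (g n) = 0"
begin

lemma norm_le_1: "norm (g n) \<le> 1"
  using zero_or_unit[of n] by auto

lemma weighted_series:
  assumes "\<And>n. norm (c n) \<le> M"
  shows summable_weighted_series: "summable (\<lambda>n. (1/2)^n *\<^sub>R (c n *\<^sub>C g n))"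
    and norm_weighted_series_le: "norm (\<Sum>n. (1/2)^n *\<^sub>R (c n *\<^sub>C g n)) \<le> 2 * M"
proof -
  have bound: "norm ((1/2)^n *\<^sub>R (c n *\<^sub>C g n)) \<le> M * (1/2)^n" for n
  proof -
    have "norm (c n) * norm (g n) \<le> M * 1"
      using assms[of n] norm_le_1[of n] by (intro mult_mono) (auto intro: order_trans[OF norm_ge_zero])
    then show ?thesis
      using mult_right_mono[of "norm (c n) * norm (g n)" "M" "(1/2)^n"]
      by (simp add: norm_scaleC mult.commute)
  qed
  have geometric: "summable (\<lambda>n. M * (1/2 :: real)^n)"
    by (intro summable_mult summable_geometric) simp
  show "summable (\<lambda>n. (1/2)^n *\<^sub>R (c n *\<^sub>C g n))"
    by (rule summable_comparison_test'[OF geometric bound])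
  have "(\<Sum>n. M * (1/2 :: real)^n) = 2 * M"
    by (subst suminf_mult) (simp_all add: summable_geometric suminf_geometric)
  then show "norm (\<Sum>n. (1/2)^n *\<^sub>R (c n *\<^sub>C g n)) \<le> 2 * M"
    using norm_suminf_le[OF bound geometric] by simp
qed

definition diag :: "'a \<Rightarrow> 'a" where
  "diag x = (\<Sum>n. (1/2)^n *\<^sub>R (cinner x (g n) *\<^sub>C g n))"

definition weight_vec :: 'a where
  "weight_vec = (\<Sum>n. (1/2)^n *\<^sub>R g n)"

lemma norm_cinner_le: "norm (cinner x (g n)) \<le> norm x"
  using Cauchy_Schwarz_cinner[of x "g n"] norm_le_1[of n] mult_left_mono[of "norm (g n)" 1 "norm x"]
  by simp

lemma summable_diag: "summable (\<lambda>n. (1/2)^n *\<^sub>R (cinner x (g n) *\<^sub>C g n))"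
  by (rule summable_weighted_series[OF norm_cinner_le])

lemma summable_weight_vec: "summable (\<lambda>n. (1/2)^n *\<^sub>R g n)"
  using summable_weighted_series[of "\<lambda>_. 1" 1] by (simp add: scaleC_one)

lemma norm_diag_le: "norm (diag x) \<le> 2 * norm x"
  unfolding diag_def by (rule norm_weighted_series_le[OF norm_cinner_le])

lemma norm_weight_vec_le: "norm weight_vec \<le> 2"
  unfolding weight_vec_def using norm_weighted_series_le[of "\<lambda>_. 1" 1] by (simp add: scaleC_one)

lemma diag_add: "diag (x + y) = diag x + diag y"
  unfolding diag_def suminf_add[OF summable_diag summable_diag]
  by (simp add: cinner_simps scaleC_add_left scaleR_add_right)

lemma diag_scaleC: "diag (a *\<^sub>C x) = a *\<^sub>C diag x"
  unfolding diag_def bounded_linear.suminf[OF bounded_linear_scaleC_right summable_diag]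
  by (simp add: cinner_simps scaleC_scaleR scaleC_scaleC)

lemma cinner_diag: "cinner (diag x) y = cinner x (diag y)"
  unfolding diag_def bounded_linear.suminf[OF bounded_linear_cinner_left summable_diag]
    bounded_linear.suminf[OF bounded_linear_cinner_right summable_diag]
  by (rule suminf_cong) (simp add: cinner_simps cinner_commute[symmetric])

lemma diag_g: "diag (g n) = (1/2)^n *\<^sub>R g n"
proof -
  have "diag (g n) = (\<Sum>m\<in>{n}. (1/2)^m *\<^sub>R (cinner (g n) (g m) *\<^sub>C g m))"
    unfolding diag_def by (rule suminf_finite) (use orthogonal in auto)
  then show ?thesis
    using zero_or_unit[of n] by (auto simp: cinner_self scaleC_one)
qed

lemma cinner_weight_vec: "cinner weight_vec (g n) = of_real ((1/2)^n) * cinner (g n) (g n)"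
proof -
  have "cinner weight_vec (g n) = (\<Sum>m. of_real ((1/2)^m) * cinner (g m) (g n))"
    unfolding weight_vec_def bounded_linear.suminf[OF bounded_linear_cinner_left summable_weight_vec]
    by (simp add: cinner_simps)
  also have "\<dots> = (\<Sum>m\<in>{n}. of_real ((1/2)^m) * cinner (g m) (g n))"
    by (rule suminf_finite) (use orthogonal in auto)
  finally show ?thesis
    by simp
qed

text \<open>
  Real multiples of the self-adjoint \<open>diag\<close> separate the eigenvalues of the real part, and those of the
  rank-one operator \<open>x \<mapsto> \<langle>x, weight_vec\<rangle> weight_vec\<close> fill the matrix of the imaginary part: at nonzero \<open>g m\<close>, \<open>g n\<close> this
  operator has the entry \<open>(1/2)^(m + n)\<close>.  Both are compact, self-adjoint and commute with every conjugation fixing all \<open>g n\<close>,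
  so adding them preserves complex symmetry.
\<close>

definition pert :: "real \<Rightarrow> 'a \<Rightarrow> 'a" where
  "pert t x = t *\<^sub>R (diag x + (\<i> * cinner x weight_vec) *\<^sub>C weight_vec)"

definition pert_adj :: "real \<Rightarrow> 'a \<Rightarrow> 'a" where
  "pert_adj t x = t *\<^sub>R (diag x - (\<i> * cinner x weight_vec) *\<^sub>C weight_vec)"

lemma cinner_pert: "cinner (pert t x) y = cinner x (pert_adj t y)"
  unfolding pert_def pert_adj_def
  by (simp add: cinner_simps cinner_diag cinner_commute[symmetric] algebra_simps)

lemma norm_pert_le:
  assumes "t \<ge> 0"
  shows "norm (pert t x) \<le> 6 * t * norm x"
proof -
  have "norm (cinner x weight_vec) * norm weight_vec \<le> (norm x * 2) * 2"
    using Cauchy_Schwarz_cinner[of x weight_vec] norm_weight_vec_le mult_left_mono[OF norm_weight_vec_le, of "norm x"]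
    by (intro mult_mono) auto
  then have "norm (diag x + (\<i> * cinner x weight_vec) *\<^sub>C weight_vec) \<le> 6 * norm x"
    using norm_triangle_ineq[of "diag x" "(\<i> * cinner x weight_vec) *\<^sub>C weight_vec"] norm_diag_le[of x]
    by (simp add: norm_scaleC norm_mult)
  then show ?thesis
    using assms mult_left_mono[of "norm (diag x + (\<i> * cinner x weight_vec) *\<^sub>C weight_vec)" "6 * norm x" t]
    by (simp add: pert_def mult_ac)
qed

lemma bounded_clinear_pert:
  assumes "t \<ge> 0"
  shows "bounded_clinear (pert t)"
  by (rule bounded_clinearI[OF _ _ norm_pert_le[OF assms]])
    (simp_all add: pert_def diag_add diag_scaleC cinner_simps scaleC_scaleR scaleC_add_left
      scaleC_add_right scaleC_scaleC scaleR_add_right algebra_simps)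

text \<open>
  The rank-one term needs no separate treatment: expanding \<open>weight_vec\<close> puts it into the same weighted series as \<open>diag x\<close>.
\<close>

lemma compact_operator_pert:
  assumes "t \<ge> 0"
  shows "compact_operator (pert t)"
proof (rule compact_operator_weighted_series[OF bounded_clinear_pert[OF assms] norm_le_1])
  let ?c = "\<lambda>n x. of_real t * (cinner x (g n) + \<i> * cinner x weight_vec)"
  show "norm (?c n x) \<le> t * 3" if "norm x \<le> 1" for n x
  proof -
    have "norm (cinner x weight_vec) \<le> 1 * 2"
      using Cauchy_Schwarz_cinner[of x weight_vec] that norm_weight_vec_le mult_mono[OF that norm_weight_vec_le] by simp
    then have "norm (cinner x (g n) + \<i> * cinner x weight_vec) \<le> 3"
      using norm_cinner_le[of x n] that norm_triangle_ineq[of "cinner x (g n)" "\<i> * cinner x weight_vec"]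
      by (simp add: norm_mult)
    then show ?thesis
      using assms by (simp add: norm_mult mult_left_mono)
  qed
  show "(\<lambda>n. (1/2)^n *\<^sub>R (?c n x *\<^sub>C g n)) sums pert t x" for x
  proof -
    have "(\<lambda>n. (\<i> * cinner x weight_vec) *\<^sub>C ((1/2)^n *\<^sub>R g n)) sums ((\<i> * cinner x weight_vec) *\<^sub>C weight_vec)"
      unfolding weight_vec_def
      by (rule bounded_linear.sums[OF bounded_linear_scaleC_right summable_sums[OF summable_weight_vec]])
    from sums_scaleR_right[OF sums_add[OF summable_sums[OF summable_diag] this], of t x]
    show ?thesis
      unfolding pert_def diag_def
      by (simp add: scaleC_scaleR scaleC_scaleC scaleC_add_left scaleR_add_right
          scaleC_of_real algebra_simps flip: scaleC_scaleC)
  qed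
qed

lemma conjugation_pert:
  assumes C: "conjugation C" and g: "\<And>n. C (g n) = g n"
  shows "C (pert t (C x)) = pert_adj t x"
proof -
  interpret C: bounded_linear C
    using C by (rule bounded_linear_conjugation)
  have "C (diag y) = diag (C y)" for y
    unfolding diag_def C.suminf[OF summable_diag]
    by (simp add: C.scaleR conjugation_scaleC[OF C] cnj_cinner_fixed[OF C] g)
  moreover have weight_vec: "C weight_vec = weight_vec"
    unfolding weight_vec_def C.suminf[OF summable_weight_vec]
    by (simp add: C.scaleR g)
  ultimately show ?thesis
    unfolding pert_def pert_adj_def
    by (simp add: C.scaleR C.add conjugationD[OF C] cnj_cinner_fixed[OF C])
qed

end

text \<open>
  The basis \<open>g\<close> diagonalizes \<open>T + T\<^sup>*\<close>, with eigenvalues \<open>s n\<close>.  Only countably many parameters \<open>t\<close> make two of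
  the perturbed eigenvalues \<open>s n + 2 t (1/2)^n\<close> agree or make an entry of the perturbed \<open>T - T\<^sup>*\<close> vanish, so a good one exists in every interval.
\<close>

lemma irreducible_perturbation_if_real_part_diagonal:
  fixes T :: "'a :: chilbert_space \<Rightarrow> 'a"
  assumes sep: "separable_space (euclidean :: 'a topology)"
    and T: "complex_symmetric T"
    and diagonal: "diagonal_operator (\<lambda>x. T x + cadjoint T x)"
    and "\<epsilon> > 0"
  obtains K :: "'a \<Rightarrow> 'a" where
    "compact_operator K" "onorm K < \<epsilon>"
    "complex_symmetric (\<lambda>x. T x + K x)" "irreducible_operator (\<lambda>x. T x + K x)"
proof -
  obtain C where C: "conjugation C" and CTC: "C \<circ> T \<circ> C = cadjoint T" and bT: "bounded_clinear T"
    using T unfolding complex_symmetric_def by blast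
  define S where "S x = T x + cadjoint T x" for x
  have adj: "cinner (T x) y = cinner x (cadjoint T y)" for x y
    using bT by (rule cinner_cadjoint)
  have adj': "cinner (cadjoint T x) y = cinner x (T y)" for x y
    by (subst (1 2) cinner_commute) (simp only: adj)
  have CT: "cadjoint T x = C (T (C x))" for x
    using CTC by (metis comp_apply)
  have "S (C x) = C (S x)" for x
    unfolding S_def CT by (simp add: conjugationD[OF C] add.commute)
  moreover have "cinner (S x) y = cinner x (S y)" for x y
    unfolding S_def by (simp add: cinner_simps adj adj' add.commute)
  moreover have "diagonal_operator S"
    using diagonal unfolding S_def .
  ultimately obtain g s where zu: "\<And>n :: nat. g n = 0 \<or> norm (g n) = 1"
    and orth: "\<And>m n. m \<noteq> n \<Longrightarrow> cinner (g m) (g n) = 0"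
    and total: "\<And>x. (\<And>n. cinner (g n) x = 0) \<Longrightarrow> x = 0"
    and fixed: "\<And>n. C (g n) = g n"
    and eig: "\<And>n. S (g n) = s n *\<^sub>R g n"
    using conjugation_fixed_eigenbasis[OF sep C] by metis
  interpret orthonormal_sequence g
    by standard (use zu orth in auto)
  \<comment> \<open>\<open>b\<^sub>1 + t a\<^sub>1\<close> are the differences of the perturbed eigenvalues, \<open>b\<^sub>2 + t a\<^sub>2\<close> the entries of the perturbed \<open>T - T\<^sup>*\<close>.
    The pairs where the slope vanishes are those with \<open>m = n\<close>, respectively those with \<open>g m = 0\<close> or \<open>g n = 0\<close>; they impose no condition.\<close>
  define a\<^sub>1 b\<^sub>1 :: "nat \<times> nat \<Rightarrow> complex"
    where "a\<^sub>1 = (\<lambda>(m, n). of_real (2 * (1/2)^m - 2 * (1/2)^n))"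
      and "b\<^sub>1 = (\<lambda>(m, n). of_real (s m - s n))"
  define a\<^sub>2 b\<^sub>2 :: "nat \<times> nat \<Rightarrow> complex"
    where "a\<^sub>2 = (\<lambda>(m, n). 2 * \<i> * cinner (g m) weight_vec * cinner weight_vec (g n))"
      and "b\<^sub>2 = (\<lambda>(m, n). cinner (T (g m) - cadjoint T (g m)) (g n))"
  let ?bad = "\<lambda>a b. {t :: real. \<exists>i :: nat \<times> nat. a i \<noteq> 0 \<and> b i + complex_of_real t * a i = 0}"
  have "countable (?bad a\<^sub>1 b\<^sub>1 \<union> ?bad a\<^sub>2 b\<^sub>2)"
    by (intro countable_Un countable_roots_of_countably_many_affine_functions)
  moreover have "uncountable {0 <..< \<epsilon> / 6}"
    using \<open>\<epsilon> > 0\<close> by (simp add: uncountable_open_interval)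
  \<comment> \<open>The norm of \<open>pert t\<close> is at most \<open>6 t\<close>.\<close>
  ultimately obtain t where t: "0 < t" "t < \<epsilon> / 6" and t_good: "t \<notin> ?bad a\<^sub>1 b\<^sub>1" "t \<notin> ?bad a\<^sub>2 b\<^sub>2"
    by (metis (lifting) UnI1 UnI2 countable_subset greaterThanLessThan_iff subsetI)
  have bTK: "bounded_clinear (\<lambda>x. T x + pert t x)"
    using bT bounded_clinear_pert t(1) by (intro bounded_clinear_add) auto
  have adj_TK: "cinner (T x + pert t x) y = cinner x (cadjoint T y + pert_adj t y)" for x y
    by (simp add: cinner_simps adj cinner_pert)
  show thesis
  proof (rule that[of "pert t"])
    show "compact_operator (pert t)"
      using t(1) by (simp add: compact_operator_pert)
    have "onorm (pert t) \<le> 6 * t"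
      using t(1) norm_pert_le[of t] by (intro onorm_bound) auto
    then show "onorm (pert t) < \<epsilon>"
      using t(2) by simp
    have "cadjoint (\<lambda>x. T x + pert t x) = (\<lambda>x. cadjoint T x + pert_adj t x)"
      by (rule cadjoint_eqI) (rule adj_TK)
    moreover have "C (T (C x) + pert t (C x)) = cadjoint T x + pert_adj t x" for x
      by (simp add: conjugation_add[OF C] CT conjugation_pert[OF C fixed])
    ultimately show "complex_symmetric (\<lambda>x. T x + pert t x)"
      unfolding complex_symmetric_def using bTK C by (auto simp: fun_eq_iff intro!: exI[of _ C])
    show "irreducible_operator (\<lambda>x. T x + pert t x)"
    proof (rule irreducible_if_distinct_eigenvalues_and_nonzero_entries[OF bTK adj_TK orth total])
      show "T (g n) + pert t (g n) + (cadjoint T (g n) + pert_adj t (g n))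
          = (s n + 2 * t * (1/2)^n) *\<^sub>R g n" for n
      proof -
        have "pert t (g n) + pert_adj t (g n) = (2 * t) *\<^sub>R diag (g n)"
          unfolding pert_def pert_adj_def by (simp add: algebra_simps scaleR_2 flip: scaleR_scaleR)
        moreover have "T (g n) + cadjoint T (g n) = s n *\<^sub>R g n"
          using eig[of n] unfolding S_def .
        ultimately show ?thesis
          by (simp add: diag_g scaleR_add_left algebra_simps)
      qed
      show "s m + 2 * t * (1/2)^m \<noteq> s n + 2 * t * (1/2)^n" if "m \<noteq> n" for m n
      proof
        assume eq: "s m + 2 * t * (1/2)^m = s n + 2 * t * (1/2)^n"
        have "(1/2 :: real)^m \<noteq> (1/2)^n"
          using that by (simp add: power_inject_exp')
        then have "a\<^sub>1 (m, n) \<noteq> 0"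
          unfolding a\<^sub>1_def by (simp only: case_prod_conv of_real_eq_0_iff)
        moreover have "b\<^sub>1 (m, n) + complex_of_real t * a\<^sub>1 (m, n) = of_real (s m - s n + t * (2 * (1/2)^m - 2 * (1/2)^n))"
          unfolding a\<^sub>1_def b\<^sub>1_def by (simp only: case_prod_conv of_real_add of_real_mult)
        moreover have "s m - s n + t * (2 * (1/2)^m - 2 * (1/2)^n) = 0"
          using eq by (simp add: algebra_simps)
        ultimately show False
          using t_good(1) by auto
      qed
      show "cinner (T (g m) + pert t (g m) - (cadjoint T (g m) + pert_adj t (g m))) (g n) \<noteq> 0"
        if "g m \<noteq> 0" "g n \<noteq> 0" for m n
      proof
        assume zero: "cinner (T (g m) + pert t (g m) - (cadjoint T (g m) + pert_adj t (g m))) (g n) = 0"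
        have "cinner (g m) weight_vec = cnj (cinner weight_vec (g m))"
          by (rule cinner_commute)
        then have "a\<^sub>2 (m, n) \<noteq> 0"
          unfolding a\<^sub>2_def using that by (simp add: cinner_weight_vec)
        moreover have "b\<^sub>2 (m, n) + of_real t * a\<^sub>2 (m, n) = 0"
          using zero unfolding a\<^sub>2_def b\<^sub>2_def pert_def pert_adj_def by (simp add: cinner_simps algebra_simps)
        ultimately show False
          using t_good(2) by blast
      qed
    qed
  qed
qed

section \<open>Rotating the operator by a phase\<close>

lemma cinner_scaled_adjoint:
  assumes "\<And>x y. cinner (T x) y = cinner x (T' y :: 'a :: complex_inner)"
  shows "cinner (a *\<^sub>C T x) y = cinner x (cnj a *\<^sub>C T' y)"
  by (simp add: cinner_simps assms)

lemma complex_symmetric_scaleC: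
  fixes T :: "'a :: chilbert_space \<Rightarrow> 'a"
  assumes "complex_symmetric T"
  shows "complex_symmetric (\<lambda>x. a *\<^sub>C T x)"
proof -
  obtain C where C: "conjugation C" and CTC: "C \<circ> T \<circ> C = cadjoint T" and T: "bounded_clinear T"
    using assms unfolding complex_symmetric_def by blast
  have "cadjoint (\<lambda>x. a *\<^sub>C T x) = (\<lambda>x. cnj a *\<^sub>C cadjoint T x)"
    by (rule cadjoint_eqI) (rule cinner_scaled_adjoint[OF cinner_cadjoint[OF T]])
  then have "C \<circ> (\<lambda>x. a *\<^sub>C T x) \<circ> C = cadjoint (\<lambda>x. a *\<^sub>C T x)"
    unfolding CTC[symmetric] by (simp add: fun_eq_iff conjugation_scaleC[OF C])
  then show ?thesis
    using C bounded_clinear_scaleC[OF T] unfolding complex_symmetric_def by blast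
qed

lemma irreducible_operator_scaleC:
  fixes T :: "'a :: complex_inner \<Rightarrow> 'a"
  assumes "irreducible_operator T" and "a \<noteq> 0"
  shows "irreducible_operator (\<lambda>x. a *\<^sub>C T x)"
proof -
  have T: "bounded_clinear T"
    and irr: "\<And>P. projection P \<Longrightarrow> P \<circ> T = T \<circ> P \<Longrightarrow> P = (\<lambda>x. 0) \<or> P = id"
    using assms(1) unfolding irreducible_operator_def by blast+
  have "P \<circ> T = T \<circ> P" if "projection P" "P \<circ> (\<lambda>x. a *\<^sub>C T x) = (\<lambda>x. a *\<^sub>C T x) \<circ> P" for P
  proof
    fix x
    have "a *\<^sub>C P (T x) = a *\<^sub>C T (P x)"
      using that unfolding projection_def bounded_clinear_def by (metis comp_apply)
    then show "(P \<circ> T) x = (T \<circ> P) x"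
      using \<open>a \<noteq> 0\<close> by simp
  qed
  then show ?thesis
    unfolding irreducible_operator_def using bounded_clinear_scaleC[OF T] irr by blast
qed

lemma compact_operator_scaleC:
  fixes K :: "'a :: complex_inner \<Rightarrow> 'a"
  assumes "compact_operator K"
  shows "compact_operator (\<lambda>x. a *\<^sub>C K x)"
proof -
  have K: "bounded_clinear K" and "compact (closure (K ` cball 0 1))"
    using assms unfolding compact_operator_def by auto
  then have compact: "compact ((*\<^sub>C) a ` closure (K ` cball 0 1))"
    by (intro compact_continuous_image linear_continuous_on bounded_linear_scaleC_right)
  have "(\<lambda>x. a *\<^sub>C K x) ` cball 0 1 \<subseteq> (*\<^sub>C) a ` closure (K ` cball 0 1)"
    using closure_subset[of "K ` cball 0 1"] by blast
  then have "closure ((\<lambda>x. a *\<^sub>C K x) ` cball 0 1) \<subseteq> (*\<^sub>C) a ` closure (K ` cball 0 1)"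
    using compact by (simp add: closure_minimal compact_imp_closed)
  then have "compact (closure ((\<lambda>x. a *\<^sub>C K x) ` cball 0 1))"
    using compact_Int_closed[OF compact closed_closure] by (metis inf.absorb2)
  then show ?thesis
    unfolding compact_operator_def using bounded_clinear_scaleC[OF K] by blast
qed

lemma diagonal_operator_scaleC:
  assumes "diagonal_operator T"
  shows "diagonal_operator (\<lambda>x. a *\<^sub>C T x)"
  using assms unfolding diagonal_operator_def eigenvector_def
  by (metis bounded_clinear_scaleC scaleC_scaleC)

text \<open>
  The case of a diagonal \<open>T - T\<^sup>*\<close> reduces to the other one by passing to \<open>\<i> T\<close>, whose sum with its adjoint is
  \<open>\<i> (T - T\<^sup>*)\<close>; rotating back by \<open>-\<i>\<close> keeps compactness, norm, complex symmetry and irreducibility.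
\<close>

theorem theorem2p1:
  fixes T :: "'a :: chilbert_space \<Rightarrow> 'a"
  assumes "separable_space (euclidean :: 'a topology)"
    and "bounded_clinear T"
    and "complex_symmetric T"
    and "diagonal_operator (\<lambda>x. T x + cadjoint T x) \<or>
         diagonal_operator (\<lambda>x. T x - cadjoint T x)"
  shows "\<forall>\<epsilon>>0. \<exists>K :: 'a \<Rightarrow> 'a.
           compact_operator K \<and> onorm K < \<epsilon> \<and>
           complex_symmetric (\<lambda>x. T x + K x) \<and>
           irreducible_operator (\<lambda>x. T x + K x)"
proof (intro allI impI)
  fix \<epsilon> :: real assume "\<epsilon> > 0"
  show "\<exists>K :: 'a \<Rightarrow> 'a. compact_operator K \<and> onorm K < \<epsilon> \<and>
      complex_symmetric (\<lambda>x. T x + K x) \<and> irreducible_operator (\<lambda>x. T x + K x)"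
    using assms(4)
  proof
    assume "diagonal_operator (\<lambda>x. T x + cadjoint T x)"
    with assms(1,3) \<open>\<epsilon> > 0\<close> show ?thesis
      using irreducible_perturbation_if_real_part_diagonal by metis
  next
    assume diagonal: "diagonal_operator (\<lambda>x. T x - cadjoint T x)"
    define R where "R x = \<i> *\<^sub>C T x" for x
    have "cadjoint R = (\<lambda>x. cnj \<i> *\<^sub>C cadjoint T x)"
      unfolding R_def by (rule cadjoint_eqI) (rule cinner_scaled_adjoint[OF cinner_cadjoint[OF assms(2)]])
    then have "(\<lambda>x. R x + cadjoint R x) = (\<lambda>x. \<i> *\<^sub>C (T x - cadjoint T x))"
      by (simp add: R_def fun_eq_iff complex_vector.scale_right_diff_distrib)
    then have "diagonal_operator (\<lambda>x. R x + cadjoint R x)"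
      using diagonal_operator_scaleC[OF diagonal] by simp
    moreover have "complex_symmetric R"
      unfolding R_def using assms(3) by (rule complex_symmetric_scaleC)
    ultimately obtain K where K: "compact_operator K" "onorm K < \<epsilon>"
      "complex_symmetric (\<lambda>x. R x + K x)" "irreducible_operator (\<lambda>x. R x + K x)"
      using irreducible_perturbation_if_real_part_diagonal[OF assms(1) _ _ \<open>\<epsilon> > 0\<close>] by metis
    have rotate: "(\<lambda>x. T x + (- \<i>) *\<^sub>C K x) = (\<lambda>x. (- \<i>) *\<^sub>C (R x + K x))"
      by (simp add: R_def fun_eq_iff scaleC_add_right scaleC_scaleC scaleC_one)
    show ?thesis
    proof (intro exI conjI)
      show "compact_operator (\<lambda>x. (- \<i>) *\<^sub>C K x)"
        using K(1) by (rule compact_operator_scaleC)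
      show "onorm (\<lambda>x. (- \<i>) *\<^sub>C K x) < \<epsilon>"
        using K(2) unfolding onorm_def norm_scaleC by simp
      show "complex_symmetric (\<lambda>x. T x + (- \<i>) *\<^sub>C K x)"
        unfolding rotate using K(3) by (rule complex_symmetric_scaleC)
      show "irreducible_operator (\<lambda>x. T x + (- \<i>) *\<^sub>C K x)"
        unfolding rotate using K(4) by (rule irreducible_operator_scaleC) simp
    qed
  qed
qed

end
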